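(* Let $A$ be a contractible pointed space with closed base point and let $X$ be a $CW(A)$-complex. Then $X$ is contractible.
   Context: All spaces are pointed, all maps are pointed, and homotopies (in particular contractions) preserve base points. $\mathrm{C}X$ is the reduced cone, $\Sigma X$ the reduced suspension, $\Sigma^0A=A$. For $n\ge 1$, $X$ is obtained from a pointed space $Z$ by attaching $n$-cells of type $A$ if $X$ is a pushout of $Z\xleftarrow{\,g\,}\bigvee_{\alpha\in J}\Sigma^{n-1}A\xrightarrow{\,i\,}\bigvee_{\alpha\in J}\mathrm{C}\Sigma^{n-1}A$ for some index set $J$ and some map $g$, where $i$ is the wedge of the inclusions as bases of the cones. $X$ is obtained from $Z$ by attaching $0$-cells of type $A$ if $X=Z\vee\bigvee_{\alpha\in J}A$. A $CW(A)$-complex is a space $X$ that is the colimit of a sequence $*=X^{-1}\to X^0\to X^1\to\cdots$ such that, for all $n\ge 0$, $X^n$ is obtained from $X^{n-1}$ by attaching $n$-cells of type $A$. *)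

theory Defs
  imports "HOL-Analysis.Analysis"
begin

section \<open>Pointed spaces\<close>

text \<open>A pointed space is a topology together with a base point in its carrier. No separation or
  compact generation axiom is imposed.\<close>

type_synonym 'a pspace = "'a topology \<times> 'a"

definition pointed_space :: "'a pspace \<Rightarrow> bool" where
  "pointed_space X \<longleftrightarrow> snd X \<in> topspace (fst X)"

definition pointed_map :: "'a pspace \<Rightarrow> 'b pspace \<Rightarrow> ('a \<Rightarrow> 'b) \<Rightarrow> bool" where
  "pointed_map X Y f \<longleftrightarrow> continuous_map (fst X) (fst Y) f \<and> f (snd X) = snd Y"

definition pointed_homeo :: "'a pspace \<Rightarrow> 'b pspace \<Rightarrow> ('a \<Rightarrow> 'b) \<Rightarrow> bool" where
  "pointed_homeo X Y f \<longleftrightarrow> homeomorphic_map (fst X) (fst Y) f \<and> f (snd X) = snd Y"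

definition pointed_contractible :: "'a pspace \<Rightarrow> bool" where
  "pointed_contractible X \<longleftrightarrow>
     homotopic_with (\<lambda>h. h (snd X) = snd X) (fst X) (fst X) id (\<lambda>_. snd X)"


section \<open>Quotients\<close>

text \<open>The final topology on the set \<open>Y\<close> with respect to \<open>q\<close>; it is only used for \<open>q\<close> mapping the
  carrier of \<open>X\<close> into \<open>Y\<close>.\<close>

definition final_topology :: "'b set \<Rightarrow> 'a topology \<Rightarrow> ('a \<Rightarrow> 'b) \<Rightarrow> 'b topology" where
  "final_topology Y X q = topology (\<lambda>U. U \<subseteq> Y \<and> openin X {x \<in> topspace X. q x \<in> U})"

lemma openin_final_topology:
  "openin (final_topology Y X q) U \<longleftrightarrow> U \<subseteq> Y \<and> openin X {x \<in> topspace X. q x \<in> U}"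
proof -
  have 1: "{x \<in> topspace X. q x \<in> S \<inter> T} = {x \<in> topspace X. q x \<in> S} \<inter> {x \<in> topspace X. q x \<in> T}"
    for S T by auto
  have 2: "{x \<in> topspace X. q x \<in> \<Union>K} = (\<Union>S\<in>K. {x \<in> topspace X. q x \<in> S})" for K
    by auto
  have "istopology (\<lambda>U. U \<subseteq> Y \<and> openin X {x \<in> topspace X. q x \<in> U})"
    unfolding istopology_def 1 2 by blast
  then show ?thesis
    by (simp add: final_topology_def)
qed

lemma topspace_final_topology:
  assumes "q ` topspace X \<subseteq> Y"
  shows "topspace (final_topology Y X q) = Y"
proof -
  have "{x \<in> topspace X. q x \<in> Y} = topspace X"
    using assms by auto
  then have "openin (final_topology Y X q) Y"
    by (simp add: openin_final_topology)
  then show ?thesis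
    by (metis openin_final_topology openin_subset openin_topspace subset_antisym)
qed

lemma quotient_map_final_topology:
  "quotient_map X (final_topology (q ` topspace X) X q) q"
  by (simp add: quotient_map_def topspace_final_topology openin_final_topology)

text \<open>\<open>collapse X S\<close> is the quotient \<open>X/S\<close>. The point to which \<open>S\<close> is collapsed is \<open>None\<close>, a point
  outside \<open>S\<close> is represented by itself. The point \<open>None\<close> is also present when \<open>S\<close> is empty, so that
  \<open>X/\<emptyset>\<close> is \<open>X\<close> with a disjoint base point; in particular an empty wedge is a one-point space.\<close>

definition collapse_map :: "'a set \<Rightarrow> 'a \<Rightarrow> 'a option" where
  "collapse_map S x = (if x \<in> S then None else Some x)"

definition collapse :: "'a topology \<Rightarrow> 'a set \<Rightarrow> 'a option pspace" where
  "collapse X S =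
     (final_topology (insert None (Some ` (topspace X - S))) X (collapse_map S), None)"

lemma topspace_collapse:
  "topspace (fst (collapse X S)) = insert None (Some ` (topspace X - S))"
  unfolding collapse_def fst_conv
  by (rule topspace_final_topology) (auto simp: collapse_map_def)

text \<open>\<open>quotient_by X r\<close> is the quotient of \<open>X\<close> by the equivalence relation generated by \<open>r\<close>; its points
  are the equivalence classes.\<close>

definition class_of :: "('a \<Rightarrow> 'a \<Rightarrow> bool) \<Rightarrow> 'a \<Rightarrow> 'a set" where
  "class_of r x = {y. equivclp r x y}"

definition quotient_by :: "'a topology \<Rightarrow> ('a \<Rightarrow> 'a \<Rightarrow> bool) \<Rightarrow> 'a set topology" where
  "quotient_by X r = final_topology (class_of r ` topspace X) X (class_of r)"

lemma class_of_eq_iff: "class_of r x = class_of r y \<longleftrightarrow> equivclp r x y"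
proof
  assume "class_of r x = class_of r y"
  moreover have "y \<in> class_of r y"
    by (simp add: class_of_def)
  ultimately show "equivclp r x y"
    by (simp add: class_of_def set_eq_iff)
next
  assume "equivclp r x y"
  then have "equivclp r x z \<longleftrightarrow> equivclp r y z" for z
    by (meson equivclp_sym equivclp_trans)
  then show "class_of r x = class_of r y"
    by (simp add: class_of_def)
qed

lemma quotient_map_quotient_by: "quotient_map X (quotient_by X r) (class_of r)"
  by (simp add: quotient_by_def quotient_map_final_topology)

lemma topspace_quotient_by: "topspace (quotient_by X r) = class_of r ` topspace X"
  by (simp add: quotient_by_def topspace_final_topology)

lemma quotient_by_universal:
  assumes f: "continuous_map X T f" and r: "\<And>x y. r x y \<Longrightarrow> f x = f y"
  shows "\<exists>k. continuous_map (quotient_by X r) T k \<and> (\<forall>x. k (class_of r x) = f x)"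
proof -
  have *: "f x = f y" if "equivclp r x y" for x y
    using that by (induction rule: equivclp_induct) (auto dest: r)
  define k where "k = (\<lambda>c. f (SOME x. class_of r x = c))"
  have k: "k (class_of r x) = f x" for x
    unfolding k_def
    by (metis (mono_tags, lifting) "*" class_of_eq_iff someI)
  then have "k \<circ> class_of r = f"
    by auto
  with f have "continuous_map (quotient_by X r) T k"
    using continuous_compose_quotient_map[OF quotient_map_quotient_by] by metis
  with k show ?thesis
    by blast
qed


section \<open>Cones, suspensions and wedges\<close>

text \<open>The cone point is at height 1 and the base of the cone at height 0.\<close>

definition reduced_cone :: "'a pspace \<Rightarrow> ('a \<times> real) option pspace" where
  "reduced_cone X =
     collapse (prod_topology (fst X) (top_of_set {0..1}))
       (topspace (fst X) \<times> {1} \<union> {snd X} \<times> {0..1})"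

definition cone_base :: "'a pspace \<Rightarrow> 'a \<Rightarrow> ('a \<times> real) option" where
  "cone_base X x = collapse_map (topspace (fst X) \<times> {1} \<union> {snd X} \<times> {0..1}) (x, 0)"

definition reduced_suspension :: "'a pspace \<Rightarrow> ('a \<times> real) option pspace" where
  "reduced_suspension X =
     collapse (prod_topology (fst X) (top_of_set {0..1}))
       (topspace (fst X) \<times> {0, 1} \<union> {snd X} \<times> {0..1})"

text \<open>The type of points of a suspension differs from that of the original space. In order to iterate
  the construction, the points of all the \<open>\<Sigma>\<^sup>n A\<close> are put into one recursive type, by
  transporting the topologies along the (injective) constructors.\<close>

datatype 'a susp_point = Susp0 'a | SuspSuc "('a susp_point \<times> real) option"

definition transport :: "('a \<Rightarrow> 'b) \<Rightarrow> 'a pspace \<Rightarrow> 'b pspace" where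
  "transport e X = (final_topology (e ` topspace (fst X)) (fst X) e, e (snd X))"

lemma pointed_homeo_transport:
  assumes "inj e"
  shows "pointed_homeo X (transport e X) e"
  using assms quotient_map_final_topology[of "fst X" e]
  by (simp add: pointed_homeo_def transport_def homeomorphic_map_def inj_on_subset[OF _ subset_UNIV])

fun iter_suspension :: "nat \<Rightarrow> 'a pspace \<Rightarrow> 'a susp_point pspace" where
  "iter_suspension 0 A = transport Susp0 A"
| "iter_suspension (Suc n) A = transport SuspSuc (reduced_suspension (iter_suspension n A))"

text \<open>The wedge of copies of \<open>X\<close> indexed by \<open>J\<close>.\<close>

definition wedge :: "'j set \<Rightarrow> 'a pspace \<Rightarrow> ('j \<times> 'a) option pspace" where
  "wedge J X = collapse (sum_topology (\<lambda>_. fst X) J) (J \<times> {snd X})"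

definition wedge_map ::
  "'j set \<Rightarrow> 'b pspace \<Rightarrow> ('a \<Rightarrow> 'b) \<Rightarrow> ('j \<times> 'a) option \<Rightarrow> ('j \<times> 'b) option" where
  "wedge_map J Y f w =
     (case w of None \<Rightarrow> None | Some (\<alpha>, x) \<Rightarrow> collapse_map (J \<times> {snd Y}) (\<alpha>, f x))"

definition disjoint_union :: "'a topology \<Rightarrow> 'b topology \<Rightarrow> ('a + 'b) topology" where
  "disjoint_union X Y = topology (\<lambda>U. openin X (Inl -` U) \<and> openin Y (Inr -` U))"

lemma openin_disjoint_union_iff:
  "openin (disjoint_union X Y) U \<longleftrightarrow> openin X (Inl -` U) \<and> openin Y (Inr -` U)"
proof -
  have "istopology (\<lambda>U. openin X (Inl -` U) \<and> openin Y (Inr -` U))"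
    unfolding istopology_def vimage_Int vimage_Union by blast
  then show ?thesis
    by (simp add: disjoint_union_def)
qed

lemma topspace_disjoint_union:
  "topspace (disjoint_union X Y) = Inl ` topspace X \<union> Inr ` topspace Y"
proof (rule subset_antisym)
  let ?U = "topspace (disjoint_union X Y)"
  have "Inl -` ?U \<subseteq> topspace X" "Inr -` ?U \<subseteq> topspace Y"
    using openin_disjoint_union_iff[of X Y ?U] by (auto dest: openin_subset)
  then have "p \<in> Inl ` topspace X \<union> Inr ` topspace Y" if "p \<in> ?U" for p
    using that by (cases p) auto
  then show "?U \<subseteq> Inl ` topspace X \<union> Inr ` topspace Y"
    by (rule subsetI)
next
  have "Inl -` (Inl ` topspace X \<union> Inr ` topspace Y) = topspace X"
    "Inr -` (Inl ` topspace X \<union> Inr ` topspace Y) = topspace Y"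
    by auto
  then have "openin (disjoint_union X Y) (Inl ` topspace X \<union> Inr ` topspace Y)"
    by (simp add: openin_disjoint_union_iff)
  then show "Inl ` topspace X \<union> Inr ` topspace Y \<subseteq> topspace (disjoint_union X Y)"
    by (rule openin_subset)
qed

lemma continuous_map_disjoint_union:
  "continuous_map (disjoint_union X Y) T f \<longleftrightarrow>
     continuous_map X T (f \<circ> Inl) \<and> continuous_map Y T (f \<circ> Inr)"
proof -
  have "Inl -` {x \<in> topspace (disjoint_union X Y). f x \<in> U} = {x \<in> topspace X. f (Inl x) \<in> U}"
    "Inr -` {x \<in> topspace (disjoint_union X Y). f x \<in> U} = {y \<in> topspace Y. f (Inr y) \<in> U}" for U
    by (auto simp: topspace_disjoint_union)
  then show ?thesis
    unfolding continuous_map_def openin_disjoint_union_iff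
    by (auto simp: topspace_disjoint_union)
qed

definition binary_wedge :: "'a pspace \<Rightarrow> 'b pspace \<Rightarrow> ('a + 'b) option pspace" where
  "binary_wedge X Y = collapse (disjoint_union (fst X) (fst Y)) {Inl (snd X), Inr (snd Y)}"

definition binary_wedge_inl :: "'a pspace \<Rightarrow> 'b pspace \<Rightarrow> 'a \<Rightarrow> ('a + 'b) option" where
  "binary_wedge_inl X Y x = collapse_map {Inl (snd X), Inr (snd Y)} (Inl x)"


section \<open>Pushouts and sequential colimits\<close>

text \<open>The pushout of \<open>Z \<leftarrow> B \<rightarrow> C\<close> with maps \<open>g\<close> and \<open>i\<close>, as a quotient of the disjoint union of \<open>Z\<close>
  and \<open>C\<close>.\<close>

definition pushout_rel ::
  "'b pspace \<Rightarrow> ('b \<Rightarrow> 'z) \<Rightarrow> ('b \<Rightarrow> 'c) \<Rightarrow> 'z + 'c \<Rightarrow> 'z + 'c \<Rightarrow> bool" where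
  "pushout_rel B g i p q \<longleftrightarrow> (\<exists>b \<in> topspace (fst B). p = Inl (g b) \<and> q = Inr (i b))"

definition pushout ::
  "'z pspace \<Rightarrow> 'b pspace \<Rightarrow> 'c pspace \<Rightarrow> ('b \<Rightarrow> 'z) \<Rightarrow> ('b \<Rightarrow> 'c) \<Rightarrow> ('z + 'c) set pspace" where
  "pushout Z B C g i =
     (quotient_by (disjoint_union (fst Z) (fst C)) (pushout_rel B g i),
      class_of (pushout_rel B g i) (Inl (snd Z)))"

definition pushout_inl :: "'b pspace \<Rightarrow> ('b \<Rightarrow> 'z) \<Rightarrow> ('b \<Rightarrow> 'c) \<Rightarrow> 'z \<Rightarrow> ('z + 'c) set" where
  "pushout_inl B g i z = class_of (pushout_rel B g i) (Inl z)"

definition pushout_inr :: "'b pspace \<Rightarrow> ('b \<Rightarrow> 'z) \<Rightarrow> ('b \<Rightarrow> 'c) \<Rightarrow> 'c \<Rightarrow> ('z + 'c) set" where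
  "pushout_inr B g i c = class_of (pushout_rel B g i) (Inr c)"

lemma pushout_square:
  assumes "pointed_map B Z g" "pointed_map B C i" "pointed_space B"
  shows "pointed_map Z (pushout Z B C g i) (pushout_inl B g i)"
    and "pointed_map C (pushout Z B C g i) (pushout_inr B g i)"
    and "\<And>b. b \<in> topspace (fst B) \<Longrightarrow> pushout_inl B g i (g b) = pushout_inr B g i (i b)"
proof -
  let ?r = "pushout_rel B g i"
  have "continuous_map (disjoint_union (fst Z) (fst C)) (fst (pushout Z B C g i)) (class_of ?r)"
    by (simp add: pushout_def quotient_imp_continuous_map quotient_map_quotient_by)
  then have c: "continuous_map (fst Z) (fst (pushout Z B C g i)) (pushout_inl B g i)"
    "continuous_map (fst C) (fst (pushout Z B C g i)) (pushout_inr B g i)"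
    by (simp_all add: continuous_map_disjoint_union comp_def pushout_inl_def[abs_def]
        pushout_inr_def[abs_def])
  show eq: "pushout_inl B g i (g b) = pushout_inr B g i (i b)" if "b \<in> topspace (fst B)" for b
    using that
    unfolding pushout_inl_def pushout_inr_def class_of_eq_iff
    by (intro r_into_equivclp) (auto simp: pushout_rel_def)
  show "pointed_map Z (pushout Z B C g i) (pushout_inl B g i)"
    using c by (simp add: pointed_map_def pushout_def pushout_inl_def)
  show "pointed_map C (pushout Z B C g i) (pushout_inr B g i)"
    using c eq[of "snd B"] assms
    by (simp add: pointed_map_def pushout_def pointed_space_def pushout_inl_def)
qed

lemma pushout_universal:
  assumes "pointed_map Z T u" "pointed_map C T v"
    and "\<And>b. b \<in> topspace (fst B) \<Longrightarrow> u (g b) = v (i b)"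
  shows "\<exists>k. pointed_map (pushout Z B C g i) T k \<and>
    (\<forall>z. k (pushout_inl B g i z) = u z) \<and> (\<forall>c. k (pushout_inr B g i c) = v c)"
proof -
  let ?Q = "quotient_by (disjoint_union (fst Z) (fst C)) (pushout_rel B g i)"
  have "continuous_map (disjoint_union (fst Z) (fst C)) (fst T) (case_sum u v)"
    using assms by (simp add: continuous_map_disjoint_union pointed_map_def case_sum_o_inj)
  moreover have "case_sum u v p = case_sum u v q" if "pushout_rel B g i p q" for p q
    using that assms(3) by (auto simp: pushout_rel_def)
  ultimately have "\<exists>k. continuous_map ?Q (fst T) k \<and>
      (\<forall>p. k (class_of (pushout_rel B g i) p) = case_sum u v p)"
    by (rule quotient_by_universal)
  then obtain k where "continuous_map ?Q (fst T) k"
    "\<And>p. k (class_of (pushout_rel B g i) p) = case_sum u v p"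
    by blast
  then show ?thesis
    using assms(1)
    by (intro exI[of _ k]) (simp add: pointed_map_def pushout_def pushout_inl_def pushout_inr_def)
qed

text \<open>The colimit of \<open>S 0 \<rightarrow> S 1 \<rightarrow> S 2 \<rightarrow> \<dots>\<close> with maps \<open>j n\<close>, as a quotient of the disjoint union of
  the \<open>S n\<close>.\<close>

definition seq_rel :: "(nat \<Rightarrow> 'a pspace) \<Rightarrow> (nat \<Rightarrow> 'a \<Rightarrow> 'a) \<Rightarrow> nat \<times> 'a \<Rightarrow> nat \<times> 'a \<Rightarrow> bool" where
  "seq_rel S j p q \<longleftrightarrow> (\<exists>n. \<exists>x \<in> topspace (fst (S n)). p = (n, x) \<and> q = (Suc n, j n x))"

definition seq_colimit :: "(nat \<Rightarrow> 'a pspace) \<Rightarrow> (nat \<Rightarrow> 'a \<Rightarrow> 'a) \<Rightarrow> (nat \<times> 'a) set pspace" where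
  "seq_colimit S j =
     (quotient_by (sum_topology (\<lambda>n. fst (S n)) UNIV) (seq_rel S j),
      class_of (seq_rel S j) (0, snd (S 0)))"

definition seq_incl ::
  "(nat \<Rightarrow> 'a pspace) \<Rightarrow> (nat \<Rightarrow> 'a \<Rightarrow> 'a) \<Rightarrow> nat \<Rightarrow> 'a \<Rightarrow> (nat \<times> 'a) set" where
  "seq_incl S j n x = class_of (seq_rel S j) (n, x)"

lemma seq_incl_cocone:
  assumes "\<And>n. pointed_space (S n)" "\<And>n. pointed_map (S n) (S (Suc n)) (j n)"
  shows "pointed_map (S n) (seq_colimit S j) (seq_incl S j n)"
    and "\<And>x. x \<in> topspace (fst (S n)) \<Longrightarrow> seq_incl S j (Suc n) (j n x) = seq_incl S j n x"
proof -
  have eq: "seq_incl S j (Suc m) (j m x) = seq_incl S j m x" if "x \<in> topspace (fst (S m))" for m x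
    unfolding seq_incl_def class_of_eq_iff
    by (rule converse_r_into_equivclp) (use that in \<open>auto simp: seq_rel_def\<close>)
  then show "\<And>x. x \<in> topspace (fst (S n)) \<Longrightarrow> seq_incl S j (Suc n) (j n x) = seq_incl S j n x" .
  have b: "seq_incl S j n (snd (S n)) = snd (seq_colimit S j)"
  proof (induction n)
    case 0
    show ?case by (simp add: seq_incl_def seq_colimit_def)
  next
    case (Suc n)
    then show ?case
      using eq[of "snd (S n)" n] assms by (simp add: pointed_map_def pointed_space_def)
  qed
  have "continuous_map (fst (S n)) (sum_topology (\<lambda>n. fst (S n)) UNIV) (Pair n)"
    using continuous_map_component_injection[of n UNIV "\<lambda>n. fst (S n)"] by simp
  moreover have "continuous_map (sum_topology (\<lambda>n. fst (S n)) UNIV) (fst (seq_colimit S j))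
      (class_of (seq_rel S j))"
    by (simp add: seq_colimit_def quotient_imp_continuous_map quotient_map_quotient_by)
  ultimately have "continuous_map (fst (S n)) (fst (seq_colimit S j))
      (class_of (seq_rel S j) \<circ> Pair n)"
    by (rule continuous_map_compose)
  then show "pointed_map (S n) (seq_colimit S j) (seq_incl S j n)"
    using b by (simp add: pointed_map_def comp_def seq_incl_def[abs_def])
qed

lemma seq_colimit_universal:
  assumes f: "\<And>n. pointed_map (S n) T (f n)"
    and j: "\<And>n x. x \<in> topspace (fst (S n)) \<Longrightarrow> f (Suc n) (j n x) = f n x"
  shows "\<exists>k. pointed_map (seq_colimit S j) T k \<and> (\<forall>n x. k (seq_incl S j n x) = f n x)"
proof -
  let ?F = "\<lambda>p. f (fst p) (snd p)"
  let ?Q = "quotient_by (sum_topology (\<lambda>n. fst (S n)) UNIV) (seq_rel S j)"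
  have "continuous_map (sum_topology (\<lambda>n. fst (S n)) UNIV) (fst T) ?F"
    using f by (auto simp: pointed_map_def continuous_map_def Pi_iff openin_sum_topology)
  moreover have "?F p = ?F q" if "seq_rel S j p q" for p q
    using that j by (auto simp: seq_rel_def)
  ultimately have "\<exists>k. continuous_map ?Q (fst T) k \<and> (\<forall>p. k (class_of (seq_rel S j) p) = ?F p)"
    by (rule quotient_by_universal)
  then obtain k where k: "continuous_map ?Q (fst T) k"
    "\<And>p. k (class_of (seq_rel S j) p) = ?F p"
    by blast
  then show ?thesis
    using f[of 0]
    by (intro exI[of _ k]) (simp add: pointed_map_def seq_colimit_def seq_incl_def)
qed


section \<open>CW(A)-complexes\<close>

text \<open>\<open>attach_cells n J A Z X j\<close>: the space \<open>X\<close> is obtained from \<open>Z\<close> by attaching \<open>n\<close>-cells of type \<open>A\<close>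
  indexed by \<open>J\<close>, and \<open>j\<close> is the canonical map from \<open>Z\<close> to \<open>X\<close>. Being a wedge or a pushout is
  understood up to pointed homeomorphism.\<close>

fun attach_cells ::
  "nat \<Rightarrow> 'j set \<Rightarrow> 'a pspace \<Rightarrow> 'z pspace \<Rightarrow> 'x pspace \<Rightarrow> ('z \<Rightarrow> 'x) \<Rightarrow> bool" where
  "attach_cells 0 J A Z X j \<longleftrightarrow>
     (\<exists>\<phi>. pointed_homeo (binary_wedge Z (wedge J A)) X \<phi> \<and>
          (\<forall>z \<in> topspace (fst Z). j z = \<phi> (binary_wedge_inl Z (wedge J A) z)))"
| "attach_cells (Suc m) J A Z X j \<longleftrightarrow>
     (let S = iter_suspension m A;
          B = wedge J S;
          C = wedge J (reduced_cone S);
          i = wedge_map J (reduced_cone S) (cone_base S)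
      in \<exists>g \<phi>. pointed_map B Z g \<and>
               pointed_homeo (pushout Z B C g i) X \<phi> \<and>
               (\<forall>z \<in> topspace (fst Z). j z = \<phi> (pushout_inl B g i z)))"

text \<open>The space \<open>S n\<close> is the skeleton of dimension \<open>n - 1\<close>. The two type arguments fix the types in
  which the index sets of the cells and the points of the skeleta live, since one cannot quantify
  existentially over types; theorems are stated for arbitrary such types. It is no restriction that
  all skeleta have points in one type, because they may be replaced by homeomorphic copies.\<close>

definition CW_complex :: "'j itself \<Rightarrow> 's itself \<Rightarrow> 'a pspace \<Rightarrow> 'x pspace \<Rightarrow> bool" where
  "CW_complex tj ts A X \<longleftrightarrow>
     (\<exists>(J :: nat \<Rightarrow> 'j set) (S :: nat \<Rightarrow> 's pspace) j \<phi>.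
        topspace (fst (S 0)) = {snd (S 0)} \<and>
        (\<forall>n. attach_cells n (J n) A (S n) (S (Suc n)) (j n)) \<and>
        pointed_homeo (seq_colimit S j) X \<phi>)"

end

theory Submission
  imports Defs
begin

text \<open>A pointed contraction \<open>H\<close> of \<open>Z\<close> extends strictly to the pushout obtained by attaching a cone on
  a space \<open>S\<close> with pointed contraction \<open>K\<close> along \<open>g\<close>. For \<open>x\<close> in \<open>S\<close>, let \<open>F(x, w)\<close> be the path which is
  the cone line \<open>[x, w]\<close> for \<open>w \<ge> 0\<close> and the track \<open>H(-w, g x)\<close> for \<open>w \<le> 0\<close>; it is a loop at the base
  point. The extension must map the boundary of the square of pairs \<open>(s, t)\<close> by this loop, and \<open>K\<close>
  contracts the loop, so that \<open>F(K(u, x), w)\<close> with suitable \<open>u(s, t)\<close>, \<open>w(s, t)\<close> fills the square. As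
  each contraction of a skeleton extends the previous one, they induce a contraction of the colimit.\<close>

section \<open>Homotopies on sums and quotients\<close>

abbreviation unit_interval :: "real topology" where
  "unit_interval \<equiv> top_of_set {0..1}"

section \<open>Homotopies on topological sums\<close>

lemma open_map_prod_right:
  assumes "open_map X Y e"
  shows "open_map (prod_topology Z X) (prod_topology Z Y) (\<lambda>p. (fst p, e (snd p)))"
  unfolding open_map_def
proof (intro allI impI)
  fix W assume W: "openin (prod_topology Z X) W"
  show "openin (prod_topology Z Y) ((\<lambda>p. (fst p, e (snd p))) ` W)"
    unfolding openin_prod_topology_alt
  proof (intro allI impI)
    fix z y assume "(z, y) \<in> (\<lambda>p. (fst p, e (snd p))) ` W"
    then obtain x where x: "(z, x) \<in> W" "y = e x" by auto
    with W obtain U V where UV: "openin Z U" "openin X V" "z \<in> U" "x \<in> V" "U \<times> V \<subseteq> W"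
      unfolding openin_prod_topology_alt by meson
    then have "openin Y (e ` V)" using assms by (auto simp: open_map_def)
    moreover have "U \<times> e ` V \<subseteq> (\<lambda>p. (fst p, e (snd p))) ` W"
      using UV by (force simp: image_iff)
    ultimately show "\<exists>U V. openin Z U \<and> openin Y V \<and> z \<in> U \<and> y \<in> V \<and>
        U \<times> V \<subseteq> (\<lambda>p. (fst p, e (snd p))) ` W"
      using UV x by blast
  qed
qed

text \<open>The preimage of an open set splits over the summands into images of open sets under the
  maps \<open>?e i\<close>. These are open because the injections of the summands are open and stay
  so after multiplication with \<open>Z\<close>. Hence a homotopy on a sum may be given summand by
  summand.\<close>

lemma continuous_map_prod_sum_topology:
  assumes f: "\<And>i. i \<in> J \<Longrightarrow> continuous_map (prod_topology Z (X i)) T (\<lambda>p. f (fst p, (i, snd p)))"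
  shows "continuous_map (prod_topology Z (sum_topology X J)) T f"
  unfolding continuous_map_def
proof (intro conjI allI impI)
  show "f \<in> topspace (prod_topology Z (sum_topology X J)) \<rightarrow> topspace T"
    using f by (force simp: continuous_map_def)
  fix U assume U: "openin T U"
  let ?e = "\<lambda>i p. (fst p, (i, snd p))"
  let ?W = "\<lambda>i. {p \<in> topspace (prod_topology Z (X i)). f (?e i p) \<in> U}"
  have "{p \<in> topspace (prod_topology Z (sum_topology X J)). f p \<in> U} = (\<Union>i\<in>J. ?e i ` ?W i)"
    by (force simp: image_iff)
  moreover have "openin (prod_topology Z (sum_topology X J)) (?e i ` ?W i)" if "i \<in> J" for i
    using open_map_prod_right[OF open_map_component_injection[OF that], of Z X]
      openin_continuous_map_preimage[OF f[OF that] U]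
    by (auto simp: open_map_def)
  ultimately show "openin (prod_topology Z (sum_topology X J))
      {p \<in> topspace (prod_topology Z (sum_topology X J)). f p \<in> U}"
    by auto
qed

lemma
  fixes X :: "'a topology" and Y :: "'b topology"
  shows open_map_Inl: "open_map X (disjoint_union X Y) Inl"
  and open_map_Inr: "open_map Y (disjoint_union X Y) Inr"
proof -
  have "Inl -` (Inl ` U :: ('a + 'b) set) = U" "Inr -` (Inl ` U :: ('a + 'b) set) = {}"
    "Inl -` (Inr ` V :: ('a + 'b) set) = {}" "Inr -` (Inr ` V :: ('a + 'b) set) = V" for U V
    by auto
  then show "open_map X (disjoint_union X Y) Inl" "open_map Y (disjoint_union X Y) Inr"
    by (simp_all add: open_map_def openin_disjoint_union_iff)
qed

lemma continuous_map_prod_disjoint_union: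
  assumes l: "continuous_map (prod_topology Z X) T (\<lambda>p. f (fst p, Inl (snd p)))"
    and r: "continuous_map (prod_topology Z Y) T (\<lambda>p. f (fst p, Inr (snd p)))"
  shows "continuous_map (prod_topology Z (disjoint_union X Y)) T f"
  unfolding continuous_map_def
proof (intro conjI allI impI)
  show "f \<in> topspace (prod_topology Z (disjoint_union X Y)) \<rightarrow> topspace T"
    using continuous_map_funspace[OF l] continuous_map_funspace[OF r]
    by (auto simp: Pi_iff topspace_disjoint_union)
  fix U assume U: "openin T U"
  let ?e = "\<lambda>p. (fst p, Inl (snd p))" and ?e' = "\<lambda>p. (fst p, Inr (snd p))"
  let ?W = "{p \<in> topspace (prod_topology Z X). f (?e p) \<in> U}"
  let ?W' = "{p \<in> topspace (prod_topology Z Y). f (?e' p) \<in> U}"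
  have "{p \<in> topspace (prod_topology Z (disjoint_union X Y)). f p \<in> U} = ?e ` ?W \<union> ?e' ` ?W'"
    (is "?L = ?R")
  proof (rule set_eqI)
    fix p :: "'a \<times> ('b + 'd)"
    obtain z y where p: "p = (z, y)" by (cases p)
    show "p \<in> ?L \<longleftrightarrow> p \<in> ?R"
      by (cases y) (auto simp: p topspace_disjoint_union image_iff)
  qed
  moreover have "openin (prod_topology Z (disjoint_union X Y)) (?e ` ?W)"
    using open_map_prod_right[OF open_map_Inl] openin_continuous_map_preimage[OF l U]
    by (auto simp: open_map_def)
  moreover have "openin (prod_topology Z (disjoint_union X Y)) (?e' ` ?W')"
    using open_map_prod_right[OF open_map_Inr] openin_continuous_map_preimage[OF r U]
    by (auto simp: open_map_def)
  ultimately show "openin (prod_topology Z (disjoint_union X Y))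
      {p \<in> topspace (prod_topology Z (disjoint_union X Y)). f p \<in> U}"
    by auto
qed

section \<open>Homotopies on quotients\<close>

lemma quotient_map_prod_unit_interval:
  assumes "quotient_map X Y q"
  shows "quotient_map (prod_topology unit_interval X) (prod_topology unit_interval Y)
    (\<lambda>(t, x). (t, q x))"
\<comment> \<open>The product of a quotient map with the identity of a locally compact Hausdorff
  space is again a quotient map. This is what lets homotopies descend to quotients of arbitrary
  spaces, without working in compactly generated spaces.\<close>
proof (rule quotient_map_prod_right[OF _ _ assms])
  show "locally_compact_space unit_interval"
    by (intro compact_imp_locally_compact_space) (simp add: compact_space_subtopology)
  show "Hausdorff_space unit_interval \<or> regular_space unit_interval"
    by (simp add: Hausdorff_space_subtopology)
qed

lemma continuous_map_collapse_map:
  "continuous_map X (fst (collapse X S)) (collapse_map S)"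
  unfolding continuous_map_def topspace_collapse
  by (auto simp: collapse_def openin_final_topology collapse_map_def)

text \<open>The extra point makes the map surjective also when \<open>S\<close> is empty.\<close>

lemma quotient_map_collapse:
  "quotient_map (disjoint_union X (discrete_topology {()})) (fst (collapse X S))
     (case_sum (collapse_map S) (\<lambda>_. None))"
proof -
  have "Inl -` {x \<in> topspace (disjoint_union X (discrete_topology {()})).
      case_sum (collapse_map S) (\<lambda>_. None) x \<in> U} = {x \<in> topspace X. collapse_map S x \<in> U}" for U
    by (auto simp: topspace_disjoint_union)
  then show ?thesis
    unfolding quotient_map_def topspace_collapse
    by (auto simp: openin_disjoint_union_iff topspace_disjoint_union collapse_def
        openin_final_topology collapse_map_def image_iff split: if_splits)
qed

text \<open>Continuity can be tested before collapsing, on the product of the interval with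
  \<open>X\<close> and the extra point. The value \<open>c\<close> at \<open>None\<close> is
  prescribed separately because \<open>S\<close> may be empty.\<close>

lemma continuous_map_prod_collapse:
  assumes f: "continuous_map (prod_topology unit_interval X) T f"
    and c: "c \<in> topspace T"
    and S: "\<And>t x. t \<in> {0..1} \<Longrightarrow> x \<in> topspace X \<Longrightarrow> x \<in> S \<Longrightarrow> f (t, x) = c"
  shows "continuous_map (prod_topology unit_interval (fst (collapse X S))) T
    (\<lambda>p. case snd p of None \<Rightarrow> c | Some x \<Rightarrow> f (fst p, x))"
    (is "continuous_map _ _ ?k")
proof (rule continuous_compose_quotient_map
    [OF quotient_map_prod_unit_interval[OF quotient_map_collapse]])
  show "continuous_map (prod_topology unit_interval (disjoint_union X (discrete_topology {()}))) T
     (?k \<circ> (\<lambda>(t, x). (t, case_sum (collapse_map S) (\<lambda>_. None) x)))"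
  proof (rule continuous_map_prod_disjoint_union)
    show "continuous_map (prod_topology unit_interval X) T (\<lambda>p. (?k \<circ>
       (\<lambda>(t, x). (t, case_sum (collapse_map S) (\<lambda>_. None) x))) (fst p, Inl (snd p)))"
      by (rule continuous_map_eq[OF f]) (auto simp: collapse_map_def S)
  qed (use c in simp)
qed

text \<open>The analogue of \<open>quotient_by_universal\<close> with a time parameter: at each time
  \<open>f\<close> is constant on the classes generated by \<open>r\<close>.\<close>

lemma quotient_by_prod_universal:
  assumes f: "continuous_map (prod_topology unit_interval X) T f"
    and r: "\<And>t x y. t \<in> {0..1} \<Longrightarrow> r x y \<Longrightarrow> f (t, x) = f (t, y)"
  shows "\<exists>k. continuous_map (prod_topology unit_interval (quotient_by X r)) T k \<and>
    (\<forall>t \<in> {0..1}. \<forall>x. k (t, class_of r x) = f (t, x))"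
proof -
  have *: "f (t, x) = f (t, y)" if "equivclp r x y" "t \<in> {0..1}" for t x y
    using that(1) by (induction rule: equivclp_induct) (auto dest: r[OF that(2)])
  \<comment> \<open>The chosen representative may lie outside the carrier of \<open>X\<close>; by
    \<open>*\<close> the value of \<open>f\<close> is the same on the whole class.\<close>
  define k where "k = (\<lambda>p. f (fst p, SOME x. class_of r x = snd p))"
  have k: "k (t, class_of r x) = f (t, x)" if "t \<in> {0..1}" for t x
  proof -
    have "class_of r (SOME y. class_of r y = class_of r x) = class_of r x"
      by (rule someI[of _ x]) simp
    then show ?thesis
      unfolding k_def fst_conv snd_conv by (intro *[OF _ that]) (simp add: class_of_eq_iff)
  qed
  have "continuous_map (prod_topology unit_interval X) T (k \<circ> (\<lambda>(t, x). (t, class_of r x)))"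
    by (rule continuous_map_eq[OF f]) (auto simp: k)
  then have "continuous_map (prod_topology unit_interval (quotient_by X r)) T k"
    by (rule continuous_compose_quotient_map
        [OF quotient_map_prod_unit_interval[OF quotient_map_quotient_by]])
  with k show ?thesis by blast
qed


section \<open>Pointed contractions\<close>

text \<open>The contraction is an explicit function, with time as first coordinate, because
  contractions of successive skeleta have to be compared pointwise.\<close>

definition pointed_contraction :: "'a pspace \<Rightarrow> (real \<times> 'a \<Rightarrow> 'a) \<Rightarrow> bool" where
  "pointed_contraction X H \<longleftrightarrow> pointed_space X \<and>
     continuous_map (prod_topology unit_interval (fst X)) (fst X) H \<and>
     (\<forall>x \<in> topspace (fst X). H (0, x) = x \<and> H (1, x) = snd X) \<and>
     (\<forall>t \<in> {0..1}. H (t, snd X) = snd X)"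

lemma pointed_contractible_iff:
  assumes "pointed_space X"
  shows "pointed_contractible X \<longleftrightarrow> (\<exists>H. pointed_contraction X H)"
  unfolding pointed_contractible_def pointed_contraction_def
  using assms
  \<comment> \<open>The characterization of \<open>homotopic_with\<close> requires the side
    condition on maps to depend only on their values on the carrier; this holds because the base
    point lies there.\<close>
  by (subst homotopic_with) (auto simp: pointed_space_def)

lemma pointed_contraction_in:
  "pointed_contraction X H \<Longrightarrow> t \<in> {0..1} \<Longrightarrow> x \<in> topspace (fst X) \<Longrightarrow> H (t, x) \<in> topspace (fst X)"
  by (force simp: pointed_contraction_def continuous_map_def)

text \<open>Evaluation at a time varying with the point. Taking \<open>f\<close> with values in the
  reals makes the arithmetic continuity rules available for it.\<close>

lemma continuous_map_pointed_contraction: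
  assumes "pointed_contraction X H" "continuous_map Z euclideanreal f"
    "\<And>z. z \<in> topspace Z \<Longrightarrow> f z \<in> {0..1}" "continuous_map Z (fst X) g"
  shows "continuous_map Z (fst X) (\<lambda>z. H (f z, g z))"
proof -
  have "continuous_map Z (prod_topology unit_interval (fst X)) (\<lambda>z. (f z, g z))"
    using assms by (intro continuous_map_pairedI) (auto simp: continuous_map_in_subtopology)
  moreover have "continuous_map (prod_topology unit_interval (fst X)) (fst X) H"
    using assms(1) by (simp add: pointed_contraction_def)
  ultimately show ?thesis
    using continuous_map_compose by (fastforce simp: comp_def)
qed

text \<open>Conjugation with the homeomorphism. The equation is recorded so that strict extension of
  contractions survives the passage to a homeomorphic copy.\<close>

lemma pointed_contraction_homeo:
  assumes H: "pointed_contraction Y H" and \<phi>: "pointed_homeo Y X \<phi>"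
  shows "\<exists>G. pointed_contraction X G \<and>
    (\<forall>t \<in> {0..1}. \<forall>y \<in> topspace (fst Y). G (t, \<phi> y) = \<phi> (H (t, y)))"
proof -
  obtain \<psi> where "homeomorphic_maps (fst Y) (fst X) \<phi> \<psi>"
    using \<phi> by (auto simp: pointed_homeo_def homeomorphic_map_maps)
  then have c: "continuous_map (fst Y) (fst X) \<phi>" "continuous_map (fst X) (fst Y) \<psi>"
    and inv: "\<And>y. y \<in> topspace (fst Y) \<Longrightarrow> \<psi> (\<phi> y) = y"
      "\<And>x. x \<in> topspace (fst X) \<Longrightarrow> \<phi> (\<psi> x) = x"
    by (auto simp: homeomorphic_maps_def)
  have Y: "snd Y \<in> topspace (fst Y)"
    using H by (simp add: pointed_contraction_def pointed_space_def)
  have bX: "snd X = \<phi> (snd Y)" using \<phi> by (simp add: pointed_homeo_def)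
  define G where "G = (\<lambda>p. \<phi> (H (fst p, \<psi> (snd p))))"
  have "continuous_map (prod_topology unit_interval (fst X)) (fst Y) (\<lambda>p. H (fst p, \<psi> (snd p)))"
  proof (rule continuous_map_pointed_contraction[OF H])
    show "continuous_map (prod_topology unit_interval (fst X)) euclideanreal fst"
      by (rule continuous_map_into_fulltopology[OF continuous_map_fst])
    show "continuous_map (prod_topology unit_interval (fst X)) (fst Y) (\<lambda>p. \<psi> (snd p))"
      by (rule continuous_map_compose[OF continuous_map_snd c(2), unfolded comp_def])
  qed auto
  from continuous_map_compose[OF this c(1)]
  have "continuous_map (prod_topology unit_interval (fst X)) (fst X) G"
    by (simp add: G_def comp_def)
  moreover have "snd X \<in> topspace (fst X)"
    using c Y by (auto simp: bX continuous_map_def)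
  moreover have "\<psi> x \<in> topspace (fst Y)" if "x \<in> topspace (fst X)" for x
    using c that by (auto simp: continuous_map_def)
  ultimately have "pointed_contraction X G"
    using H Y inv by (auto simp: pointed_contraction_def pointed_space_def G_def bX)
  with inv show ?thesis by (auto simp: G_def)
qed

text \<open>Deforming \<open>X\<close> into \<open>S\<close> while keeping \<open>S\<close> inside
  itself becomes a pointed contraction once \<open>S\<close> is a single point. This is the common
  source of the contractions of wedges and suspensions below.\<close>

lemma pointed_contraction_collapse:
  assumes H: "continuous_map (prod_topology unit_interval X) X H"
    and 0: "\<And>x. x \<in> topspace X \<Longrightarrow> H (0, x) = x"
    and 1: "\<And>x. x \<in> topspace X \<Longrightarrow> H (1, x) \<in> S"
    and S: "\<And>t x. t \<in> {0..1} \<Longrightarrow> x \<in> topspace X \<Longrightarrow> x \<in> S \<Longrightarrow> H (t, x) \<in> S"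
  shows "pointed_contraction (collapse X S)
    (\<lambda>p. case snd p of None \<Rightarrow> None | Some x \<Rightarrow> collapse_map S (H (fst p, x)))"
proof -
  have "continuous_map (prod_topology unit_interval (fst (collapse X S))) (fst (collapse X S))
    (\<lambda>p. case snd p of None \<Rightarrow> None | Some x \<Rightarrow> collapse_map S (H (fst p, x)))"
    by (rule continuous_map_prod_collapse
        [OF continuous_map_compose[OF H continuous_map_collapse_map], unfolded comp_def])
      (auto simp: topspace_collapse collapse_map_def S)
  moreover have "snd (collapse X S) = None" by (simp add: collapse_def)
  ultimately show ?thesis
    using 0 1 by (auto simp: pointed_contraction_def pointed_space_def topspace_collapse
        collapse_map_def)
qed

text \<open>All summands are contracted simultaneously with the index held fixed, so every point
  ends at a base point of a summand, and these are identified.\<close>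

lemma pointed_contraction_wedge:
  assumes K: "pointed_contraction X K"
  shows "\<exists>H. pointed_contraction (wedge J X) H"
proof -
  have "pointed_contraction (wedge J X) (\<lambda>p. case snd p of None \<Rightarrow> None
      | Some x \<Rightarrow> collapse_map (J \<times> {snd X}) ((\<lambda>p. (fst (snd p), K (fst p, snd (snd p)))) (fst p, x)))"
    unfolding wedge_def
  proof (rule pointed_contraction_collapse)
    show "continuous_map (prod_topology unit_interval (sum_topology (\<lambda>_. fst X) J))
        (sum_topology (\<lambda>_. fst X) J) (\<lambda>p. (fst (snd p), K (fst p, snd (snd p))))"
    proof (rule continuous_map_prod_sum_topology)
      fix i assume "i \<in> J"
      moreover have "continuous_map (prod_topology unit_interval (fst X)) (fst X) K"
        using K by (simp add: pointed_contraction_def)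
      ultimately show "continuous_map (prod_topology unit_interval (fst X)) (sum_topology (\<lambda>_. fst X) J)
         (\<lambda>p. (fst (snd (fst p, i, snd p)), K (fst (fst p, i, snd p), snd (snd (fst p, i, snd p)))))"
        using continuous_map_compose[OF _ continuous_map_component_injection[of i J]]
        by (fastforce simp: comp_def)
    qed
  qed (use K in \<open>auto simp: pointed_contraction_def\<close>)
  then show ?thesis by blast
qed

text \<open>\<open>K\<close> acts on the first coordinate and the height is held fixed. The two ends
  are preserved, and every point ends on the line over the base point, which is collapsed.\<close>

lemma pointed_contraction_suspension:
  assumes K: "pointed_contraction X K"
  shows "\<exists>H. pointed_contraction (reduced_suspension X) H"
proof -
  let ?S = "topspace (fst X) \<times> {0, 1} \<union> {snd X} \<times> {0..1}"
  have "pointed_contraction (reduced_suspension X) (\<lambda>p. case snd p of None \<Rightarrow> None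
      | Some x \<Rightarrow> collapse_map ?S ((\<lambda>p. (K (fst p, fst (snd p)), snd (snd p))) (fst p, x)))"
    unfolding reduced_suspension_def
  proof (rule pointed_contraction_collapse)
    show "continuous_map (prod_topology unit_interval (prod_topology (fst X) unit_interval))
        (prod_topology (fst X) unit_interval) (\<lambda>p. (K (fst p, fst (snd p)), snd (snd p)))"
    proof (intro continuous_map_pairedI continuous_map_pointed_contraction[OF K])
      show "continuous_map (prod_topology unit_interval (prod_topology (fst X) unit_interval))
          euclideanreal fst"
        by (rule continuous_map_into_fulltopology[OF continuous_map_fst])
    qed (auto intro!: continuous_map_compose[OF continuous_map_snd continuous_map_fst, unfolded comp_def]
        continuous_map_compose[OF continuous_map_snd continuous_map_snd, unfolded comp_def])
  qed (use K pointed_contraction_in[OF K] in \<open>auto simp: pointed_contraction_def\<close>)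
  then show ?thesis by blast
qed

lemma pointed_contraction_transport:
  assumes "pointed_contraction X K" "inj e"
  shows "\<exists>H. pointed_contraction (transport e X) H"
  using pointed_contraction_homeo[OF assms(1) pointed_homeo_transport[OF assms(2)]] by blast

lemma pointed_contraction_iter_suspension:
  assumes "pointed_contraction A K"
  shows "\<exists>H. pointed_contraction (iter_suspension n A) H"
proof (induction n)
  case 0
  show ?case
    using pointed_contraction_transport[OF assms, of Susp0] by (simp add: inj_def)
next
  case (Suc n)
  then obtain H where "pointed_contraction (reduced_suspension (iter_suspension n A)) H"
    using pointed_contraction_suspension by blast
  from pointed_contraction_transport[OF this, of SuspSuc] show ?case
    by (simp add: inj_def)
qed

text \<open>The two contractions are run side by side. This is the extension step for
  \<open>0\<close>-cells, with \<open>W\<close> the wedge of copies of \<open>A\<close>.\<close>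

lemma pointed_contraction_binary_wedge:
  assumes H: "pointed_contraction Z H" and K: "pointed_contraction W K"
  shows "\<exists>G. pointed_contraction (binary_wedge Z W) G \<and>
    (\<forall>t \<in> {0..1}. \<forall>z \<in> topspace (fst Z).
      G (t, binary_wedge_inl Z W z) = binary_wedge_inl Z W (H (t, z)))"
proof -
  let ?S = "{Inl (snd Z), Inr (snd W)}"
  let ?h = "\<lambda>p. case snd p of Inl z \<Rightarrow> Inl (H (fst p, z)) | Inr w \<Rightarrow> Inr (K (fst p, w))"
  let ?U = "disjoint_union (fst Z) (fst W)"
  let ?G = "\<lambda>p. case snd p of None \<Rightarrow> None | Some x \<Rightarrow> collapse_map ?S (?h (fst p, x))"
  \<comment> \<open>Continuity of the two injections is read off from that of the identity.\<close>
  have "continuous_map ?U ?U id" by simp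
  then have "continuous_map (fst Z) ?U Inl" "continuous_map (fst W) ?U Inr"
    unfolding continuous_map_disjoint_union by auto
  moreover have "continuous_map (prod_topology unit_interval (fst Z)) (fst Z) H"
    "continuous_map (prod_topology unit_interval (fst W)) (fst W) K"
    using H K by (simp_all add: pointed_contraction_def)
  ultimately have "continuous_map (prod_topology unit_interval (fst Z)) ?U (Inl \<circ> H)"
    "continuous_map (prod_topology unit_interval (fst W)) ?U (Inr \<circ> K)"
    using continuous_map_compose by blast+
  then have "continuous_map (prod_topology unit_interval ?U) ?U ?h"
    by (intro continuous_map_prod_disjoint_union) (simp_all add: comp_def)
  then have "pointed_contraction (binary_wedge Z W) ?G"
    unfolding binary_wedge_def
    by (rule pointed_contraction_collapse)
      (use H K in \<open>auto simp: pointed_contraction_def topspace_disjoint_union\<close>)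
  moreover have "?G (t, binary_wedge_inl Z W z) = binary_wedge_inl Z W (H (t, z))"
    if "t \<in> {0..1}" for t z
    using H that by (auto simp: binary_wedge_inl_def collapse_map_def pointed_contraction_def)
  ultimately show ?thesis by blast
qed


section \<open>Attaching cells\<close>

text \<open>A map from the square \<open>[0,1]\<^sup>2\<close> to the rectangle \<open>[0,1] \<times> [-1,1]\<close> which carries the edges \<open>s = 1\<close> and
  \<open>t = 1\<close> to the part of the boundary where \<open>u = 1\<close> or \<open>\<bar>w\<bar> = 1\<close>. The bound \<open>1 / 2\<close> in the denominator
  keeps it continuous at the corner \<open>(1,1)\<close>.\<close>

definition cell_time :: "real \<Rightarrow> real \<Rightarrow> real" where
  "cell_time t s = min 1 (2 * min s t)"

definition cell_height :: "real \<Rightarrow> real \<Rightarrow> real" where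
  "cell_height t s = (s - t) / max (1 - min s t) (1 / 2)"

lemma cell_time_in: "s \<in> {0..1} \<Longrightarrow> t \<in> {0..1} \<Longrightarrow> cell_time t s \<in> {0..1}"
  by (auto simp: cell_time_def)

lemma cell_height_in:
  assumes "s \<in> {0..1}" "t \<in> {0..1}"
  shows "cell_height t s \<in> {-1..1}"
proof -
  \<comment> \<open>The left side is \<open>max s t - min s t\<close>, and \<open>max s t\<close> is
    at most \<open>1\<close>.\<close>
  have "\<bar>s - t\<bar> \<le> max (1 - min s t) (1 / 2)" using assms by (auto simp: min_def max_def)
  then have "\<bar>cell_height t s\<bar> \<le> 1" by (auto simp: cell_height_def abs_divide divide_le_eq_1)
  then show ?thesis by auto
qed

text \<open>On the base of the cone the filling must follow the track of \<open>H\<close>: there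
  \<open>K\<close> is not yet running and the height \<open>- t\<close> selects \<open>H\<close> at
  time \<open>t\<close>.\<close>

lemma cell_time_height_base:
  assumes "t \<in> {0..1}"
  shows "cell_time t 0 = 0" "cell_height t 0 = - t"
  using assms by (auto simp: cell_time_def cell_height_def min_def)

text \<open>This makes the homotopy start at the identity of the cone.\<close>

lemma cell_time_height_start:
  assumes "s \<in> {0..1}"
  shows "cell_time 0 s = 0" "cell_height 0 s = s"
  using assms by (auto simp: cell_time_def cell_height_def min_def)

text \<open>For \<open>t \<le> 1 / 2\<close> the height is \<open>1\<close>; from
  \<open>1 / 2\<close> on the time is \<open>1\<close>.\<close>

lemma cell_time_height_apex:
  assumes "t \<in> {0..1}"
  shows "cell_time t 1 = 1 \<or> cell_height t 1 = 1"
  using assms by (auto simp: cell_time_def cell_height_def min_def max_def)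

text \<open>For \<open>s \<le> 1 / 2\<close> the height is \<open>-1\<close>; from
  \<open>1 / 2\<close> on the time is \<open>1\<close>.\<close>

lemma cell_time_height_end:
  assumes "s \<in> {0..1}"
  shows "cell_time 1 s = 1 \<or> cell_height 1 s = -1"
  using assms by (auto simp: cell_time_def cell_height_def min_def max_def divide_simps)

text \<open>The homotopy on the cones is chosen to agree with \<open>H\<close> along their bases, so
  that both descend together to the pushout. Agreement is strict, which is the second conclusion and
  what the colimit requires.\<close>

lemma pointed_contraction_pushout:
  assumes H: "pointed_contraction Z H" and K: "pointed_contraction S K"
    and g: "pointed_map (wedge J S) Z g"
  defines "B \<equiv> wedge J S" and "C \<equiv> wedge J (reduced_cone S)"
    and "i \<equiv> wedge_map J (reduced_cone S) (cone_base S)"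
  shows "\<exists>G. pointed_contraction (pushout Z B C g i) G \<and>
    (\<forall>t \<in> {0..1}. \<forall>z \<in> topspace (fst Z).
      G (t, pushout_inl B g i z) = pushout_inl B g i (H (t, z)))"
proof -
  let ?P = "pushout Z B C g i"
  let ?W = "topspace (fst S) \<times> {1} \<union> {snd S} \<times> {0..1}"
  let ?inl = "pushout_inl B g i" and ?inr = "pushout_inr B g i"
  let ?N = "?inr None"
  have S: "snd S \<in> topspace (fst S)" and Z: "snd Z \<in> topspace (fst Z)"
    using H K by (simp_all add: pointed_contraction_def pointed_space_def)
  have H0: "H (0, z) = z" and H1: "H (1, z) = snd Z" if "z \<in> topspace (fst Z)" for z
    using H that by (simp_all add: pointed_contraction_def)
  have Hb: "H (t, snd Z) = snd Z" if "t \<in> {0..1}" for t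
    using H that by (simp add: pointed_contraction_def)
  have K0: "K (0, x) = x" and K1: "K (1, x) = snd S" if "x \<in> topspace (fst S)" for x
    using K that by (simp_all add: pointed_contraction_def)
  have Kb: "K (t, snd S) = snd S" if "t \<in> {0..1}" for t
    using K that by (simp add: pointed_contraction_def)
  have snd_cone: "snd (reduced_cone S) = None" "snd B = None"
    by (simp_all add: reduced_cone_def collapse_def B_def wedge_def)
  have top_cone: "topspace (fst (reduced_cone S))
      = insert None (Some ` (topspace (fst S) \<times> {0..1} - ?W))"
    by (simp add: reduced_cone_def topspace_collapse)
  have top_B: "topspace (fst B) = insert None (Some ` (J \<times> topspace (fst S) - J \<times> {snd S}))"
    by (auto simp: B_def wedge_def topspace_collapse)
  have top_C: "topspace (fst C)
      = insert None (Some ` (J \<times> topspace (fst (reduced_cone S)) - J \<times> {None}))"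
    by (auto simp: C_def wedge_def topspace_collapse snd_cone)
  have gc: "continuous_map (fst B) (fst Z) g" and gb: "g None = snd Z"
    using g snd_cone by (auto simp: pointed_map_def B_def)

  have "continuous_map (disjoint_union (fst Z) (fst C)) (fst ?P) (class_of (pushout_rel B g i))"
    by (simp add: pushout_def quotient_imp_continuous_map quotient_map_quotient_by)
  then have inlc: "continuous_map (fst Z) (fst ?P) ?inl" and inrc: "continuous_map (fst C) (fst ?P) ?inr"
    by (simp_all add: continuous_map_disjoint_union comp_def pushout_inl_def[abs_def]
        pushout_inr_def[abs_def])
  have glue: "?inl (g b) = ?inr (i b)" if "b \<in> topspace (fst B)" for b
    using that unfolding pushout_inl_def pushout_inr_def class_of_eq_iff
    by (intro r_into_equivclp) (auto simp: pushout_rel_def)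
  have iN: "i None = None" by (simp add: i_def wedge_map_def)
  \<comment> \<open>\<open>None\<close> belongs to \<open>B\<close> even when \<open>J\<close> is
    empty, so gluing there always identifies the base points of \<open>Z\<close> and
    \<open>C\<close>.\<close>
  have inlN: "?inl (snd Z) = ?N"
    using glue[of None] by (simp add: gb iN top_B)
  have bP: "snd ?P = ?N" by (simp add: pushout_def flip: inlN pushout_inl_def)
  have NP: "?N \<in> topspace (fst ?P)"
    using continuous_map_funspace[OF inrc] by (auto simp: top_C)

  \<comment> \<open>\<open>e \<alpha>\<close> is the characteristic map of the cell
    \<open>\<alpha>\<close>, lifted to the cylinder over \<open>S\<close>; \<open>b \<alpha>\<close>
    is the inclusion of the summand \<open>\<alpha>\<close> into \<open>B\<close>.\<close>
  define e where "e \<alpha> p = ?inr (collapse_map (J \<times> {None}) (\<alpha>, collapse_map ?W p))" for \<alpha> p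
  define b where "b \<alpha> x = collapse_map (J \<times> {snd S}) (\<alpha>, x)" for \<alpha> x
  have ec: "continuous_map (prod_topology (fst S) unit_interval) (fst ?P) (e \<alpha>)" if "\<alpha> \<in> J" for \<alpha>
  proof -
    have "continuous_map (prod_topology (fst S) unit_interval) (fst (reduced_cone S)) (collapse_map ?W)"
      by (simp add: reduced_cone_def continuous_map_collapse_map)
    moreover have "continuous_map (fst (reduced_cone S))
        (sum_topology (\<lambda>_. fst (reduced_cone S)) J) (Pair \<alpha>)"
      using continuous_map_component_injection[of \<alpha> J "\<lambda>_. fst (reduced_cone S)"] that by simp
    moreover have "continuous_map (sum_topology (\<lambda>_. fst (reduced_cone S)) J) (fst C)
        (collapse_map (J \<times> {None}))"
      by (simp add: C_def wedge_def continuous_map_collapse_map snd_cone)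
    ultimately have "continuous_map (prod_topology (fst S) unit_interval) (fst ?P)
        (?inr \<circ> (collapse_map (J \<times> {None}) \<circ> (Pair \<alpha> \<circ> collapse_map ?W)))"
      using inrc by (intro continuous_map_compose)
    then show ?thesis by (simp add: comp_def e_def[abs_def])
  qed
  have bc: "continuous_map (fst S) (fst B) (b \<alpha>)" if "\<alpha> \<in> J" for \<alpha>
  proof -
    have "continuous_map (fst S) (sum_topology (\<lambda>_. fst S) J) (Pair \<alpha>)"
      using continuous_map_component_injection[of \<alpha> J "\<lambda>_. fst S"] that by simp
    moreover have "continuous_map (sum_topology (\<lambda>_. fst S) J) (fst B) (collapse_map (J \<times> {snd S}))"
      by (simp add: B_def wedge_def continuous_map_collapse_map)
    ultimately have "continuous_map (fst S) (fst B) (collapse_map (J \<times> {snd S}) \<circ> Pair \<alpha>)"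
      by (rule continuous_map_compose)
    then show ?thesis by (simp add: comp_def b_def[abs_def])
  qed
  have gbin: "g (b \<alpha> x) \<in> topspace (fst Z)" and bin: "b \<alpha> x \<in> topspace (fst B)"
    if "\<alpha> \<in> J" "x \<in> topspace (fst S)" for \<alpha> x
    using continuous_map_funspace[OF gc] continuous_map_funspace[OF bc[OF that(1)]] that(2) by auto
  have bb: "b \<alpha> (snd S) = None" if "\<alpha> \<in> J" for \<alpha>
    using that by (simp add: b_def collapse_map_def)
  have eW: "e \<alpha> p = ?N" if "\<alpha> \<in> J" "p \<in> ?W" for \<alpha> p
    unfolding e_def collapse_map_def using that by simp
  have e0: "e \<alpha> (x, 0) = ?inl (g (b \<alpha> x))" if "\<alpha> \<in> J" "x \<in> topspace (fst S)" for \<alpha> x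
  proof -
    have "i (b \<alpha> x) = collapse_map (J \<times> {None}) (\<alpha>, collapse_map ?W (x, 0))"
      using that by (auto simp: i_def wedge_map_def b_def cone_base_def collapse_map_def snd_cone)
    then show ?thesis using glue[OF bin[OF that]] by (simp add: e_def)
  qed

  \<comment> \<open>The loop through the cell: the cone line for heights above \<open>0\<close>, the
    track of \<open>H\<close> below. The truncations by \<open>max\<close> keep each branch defined
    and continuous on the whole strip, so that the two can be glued along height \<open>0\<close>,
    where both give the attaching map.\<close>
  define F where "F \<alpha> p = (if 0 \<le> snd p then e \<alpha> (fst p, max (snd p) 0)
      else ?inl (H (max (- snd p) 0, g (b \<alpha> (fst p)))))" for \<alpha> p
  have Fc: "continuous_map (prod_topology (fst S) (top_of_set {-1..1})) (fst ?P) (F \<alpha>)"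
    if \<alpha>: "\<alpha> \<in> J" for \<alpha>
  proof -
    let ?Q = "prod_topology (fst S) (top_of_set {-1..1::real})"
    have c2: "continuous_map ?Q euclideanreal snd"
      by (rule continuous_map_into_fulltopology[OF continuous_map_snd])
    have "continuous_map ?Q (fst ?P) (\<lambda>p. e \<alpha> (fst p, max (snd p) 0))"
    proof -
      have "continuous_map ?Q (prod_topology (fst S) unit_interval) (\<lambda>p. (fst p, max (snd p) 0))"
        by (intro continuous_map_pairedI continuous_map_into_subtopology continuous_map_real_max c2)
          (auto intro: continuous_map_fst)
      from continuous_map_compose[OF this ec[OF \<alpha>]] show ?thesis by (simp add: comp_def)
    qed
    moreover have "continuous_map ?Q (fst ?P) (\<lambda>p. ?inl (H (max (- snd p) 0, g (b \<alpha> (fst p)))))"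
    proof -
      have "continuous_map ?Q (fst Z) (\<lambda>p. g (b \<alpha> (fst p)))"
        using continuous_map_compose[OF continuous_map_compose[OF continuous_map_fst bc[OF \<alpha>]] gc]
        by (simp add: comp_def)
      then have "continuous_map ?Q (fst Z) (\<lambda>p. H (max (- snd p) 0, g (b \<alpha> (fst p))))"
        by (intro continuous_map_pointed_contraction[OF H] continuous_map_real_max
            continuous_map_minus c2) auto
      from continuous_map_compose[OF this inlc] show ?thesis by (simp add: comp_def)
    qed
    ultimately show ?thesis
      unfolding F_def
      by (intro continuous_map_cases_le c2 continuous_map_from_subtopology)
        (auto simp: e0 \<alpha> H0 gbin)
  qed
  have Fpos: "F \<alpha> (x, w) = e \<alpha> (x, w)" if "0 \<le> w" for \<alpha> x w
    using that by (simp add: F_def)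
  have Fneg: "F \<alpha> (x, - w) = ?inl (H (w, g (b \<alpha> x)))"
    if "\<alpha> \<in> J" "x \<in> topspace (fst S)" "0 \<le> w" for \<alpha> x w
    using that by (auto simp: F_def e0 H0 gbin max_def)
  \<comment> \<open>Here and in the next two facts: \<open>F\<close> is the base point over the base
    point of \<open>S\<close> and at both ends of every path.\<close>
  have Fbase: "F \<alpha> (snd S, w) = ?N" if "\<alpha> \<in> J" "w \<in> {-1..1}" for \<alpha> w
    using that by (auto simp: F_def eW bb gb Hb inlN max_def)
  have F1: "F \<alpha> (x, 1) = ?N" if "\<alpha> \<in> J" "x \<in> topspace (fst S)" for \<alpha> x
    using that by (simp add: Fpos eW)
  have Fm1: "F \<alpha> (x, -1) = ?N" if "\<alpha> \<in> J" "x \<in> topspace (fst S)" for \<alpha> x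
    using that by (simp add: Fneg H1 gbin inlN)

  \<comment> \<open>With \<open>p = (t, (x, s))\<close>, the point \<open>x\<close> is first moved
    by \<open>K\<close> and the resulting loop is then evaluated at the height given by
    \<open>(s, t)\<close>.\<close>
  define \<Phi> where "\<Phi> \<alpha> p = F \<alpha> (K (cell_time (fst p) (snd (snd p)), fst (snd p)),
      cell_height (fst p) (snd (snd p)))" for \<alpha> p
  have \<Phi>c: "continuous_map (prod_topology unit_interval (prod_topology (fst S) unit_interval))
      (fst ?P) (\<Phi> \<alpha>)" if \<alpha>: "\<alpha> \<in> J" for \<alpha>
  proof -
    let ?Q = "prod_topology unit_interval (prod_topology (fst S) unit_interval)"
    have t: "continuous_map ?Q euclideanreal fst"
      by (rule continuous_map_into_fulltopology[OF continuous_map_fst])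
    have s: "continuous_map ?Q euclideanreal (\<lambda>p. snd (snd p))"
      by (rule continuous_map_into_fulltopology
          [OF continuous_map_compose[OF continuous_map_snd continuous_map_snd, unfolded comp_def]])
    have x: "continuous_map ?Q (fst S) (\<lambda>p. fst (snd p))"
      by (rule continuous_map_compose[OF continuous_map_snd continuous_map_fst, unfolded comp_def])
    have "continuous_map ?Q euclideanreal (\<lambda>p. cell_time (fst p) (snd (snd p)))"
      unfolding cell_time_def
      by (intro continuous_map_real_min continuous_map_real_mult s t) simp_all
    then have "continuous_map ?Q (fst S) (\<lambda>p. K (cell_time (fst p) (snd (snd p)), fst (snd p)))"
      by (intro continuous_map_pointed_contraction[OF K] x) (use cell_time_in in auto)
    moreover have "continuous_map ?Q euclideanreal (\<lambda>p. cell_height (fst p) (snd (snd p)))"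
      unfolding cell_height_def
      by (intro continuous_map_real_divide continuous_map_real_max continuous_map_diff
          continuous_map_real_min s t) (simp_all add: max_def)
    then have "continuous_map ?Q (top_of_set {-1..1}) (\<lambda>p. cell_height (fst p) (snd (snd p)))"
      by (rule continuous_map_into_subtopology) (use cell_height_in in auto)
    ultimately have "continuous_map ?Q (prod_topology (fst S) (top_of_set {-1..1}))
        (\<lambda>p. (K (cell_time (fst p) (snd (snd p)), fst (snd p)), cell_height (fst p) (snd (snd p))))"
      by (rule continuous_map_pairedI)
    from continuous_map_compose[OF this Fc[OF \<alpha>]] show ?thesis
      by (simp add: comp_def \<Phi>_def[abs_def])
  qed
  \<comment> \<open>Constancy on what the cone collapses. Over the base point of \<open>S\<close>
    this holds since \<open>K\<close> fixes it; at the apex either \<open>K\<close> has reached the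
    base point or the path is at its end \<open>1\<close>.\<close>
  have \<Phi>W: "\<Phi> \<alpha> (t, p) = ?N"
    if "\<alpha> \<in> J" "t \<in> {0..1}" "p \<in> topspace (fst S) \<times> {0..1}" "p \<in> ?W" for \<alpha> t p
  proof -
    obtain x s where p: "p = (x, s)" by (cases p)
    have x: "x \<in> topspace (fst S)" and s: "s \<in> {0..1}" and xs: "s = 1 \<or> x = snd S"
      using that p by auto
    have u: "cell_time t s \<in> {0..1}" and w: "cell_height t s \<in> {-1..1}"
      using cell_time_in cell_height_in that(2) s by auto
    show ?thesis
    proof (cases "x = snd S")
      case True
      then show ?thesis using Kb[OF u] Fbase[OF that(1) w] by (simp add: \<Phi>_def p)
    next
      case False
      with xs have s1: "s = 1" by simp
      from cell_time_height_apex[OF that(2)] show ?thesis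
      proof
        assume "cell_time t 1 = 1"
        then show ?thesis using K1[OF x] Fbase[OF that(1) w] by (simp add: \<Phi>_def p s1)
      next
        assume "cell_height t 1 = 1"
        then show ?thesis
          using F1[OF that(1) pointed_contraction_in[OF K u x]] by (simp add: \<Phi>_def p s1)
      qed
    qed
  qed
  have \<Phi>start: "\<Phi> \<alpha> (0, (x, s)) = e \<alpha> (x, s)"
    if "x \<in> topspace (fst S)" "s \<in> {0..1}" for \<alpha> x s
    using that by (simp add: \<Phi>_def cell_time_height_start K0 Fpos)
  have \<Phi>end: "\<Phi> \<alpha> (1, (x, s)) = ?N"
    if "\<alpha> \<in> J" "x \<in> topspace (fst S)" "s \<in> {0..1}" for \<alpha> x s
  proof -
    have u: "cell_time 1 s \<in> {0..1}" and w: "cell_height 1 s \<in> {-1..1}"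
      using cell_time_in[OF that(3), of 1] cell_height_in[OF that(3), of 1] by auto
    from cell_time_height_end[OF that(3)] show ?thesis
    proof
      assume "cell_time 1 s = 1"
      then show ?thesis using K1[OF that(2)] Fbase[OF that(1) w] by (simp add: \<Phi>_def)
    next
      assume "cell_height 1 s = -1"
      then show ?thesis
        using Fm1[OF that(1) pointed_contraction_in[OF K u that(2)]] by (simp add: \<Phi>_def)
    qed
  qed
  have \<Phi>base: "\<Phi> \<alpha> (t, (x, 0)) = ?inl (H (t, g (b \<alpha> x)))"
    if "\<alpha> \<in> J" "x \<in> topspace (fst S)" "t \<in> {0..1}" for \<alpha> x t
    using that by (simp add: \<Phi>_def cell_time_height_base K0 Fneg)

  \<comment> \<open>\<open>C\<close> arises by two collapses, so the homotopy descends twice: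
    \<open>\<Theta>\<close> lives on the disjoint sum of the cones, \<open>\<Psi>\<close> on their
    wedge.\<close>
  define \<Theta> where "\<Theta> p = (case snd (snd p) of None \<Rightarrow> ?N | Some q \<Rightarrow> \<Phi> (fst (snd p)) (fst p, q))" for p
  have \<Theta>c: "continuous_map (prod_topology unit_interval (sum_topology (\<lambda>_. fst (reduced_cone S)) J))
      (fst ?P) \<Theta>"
  proof (rule continuous_map_prod_sum_topology)
    fix \<alpha> assume \<alpha>: "\<alpha> \<in> J"
    have "continuous_map (prod_topology unit_interval (fst (reduced_cone S))) (fst ?P)
        (\<lambda>p. case snd p of None \<Rightarrow> ?N | Some x \<Rightarrow> \<Phi> \<alpha> (fst p, x))"
      unfolding reduced_cone_def
      by (rule continuous_map_prod_collapse[OF \<Phi>c[OF \<alpha>] NP]) (use \<Phi>W \<alpha> in auto)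
    then show "continuous_map (prod_topology unit_interval (fst (reduced_cone S))) (fst ?P)
        (\<lambda>p. \<Theta> (fst p, \<alpha>, snd p))"
      unfolding \<Theta>_def fst_conv snd_conv .
  qed
  define \<Psi> where "\<Psi> p = (case snd p of None \<Rightarrow> ?N | Some q \<Rightarrow> \<Theta> (fst p, q))" for p
  have \<Psi>c: "continuous_map (prod_topology unit_interval (fst C)) (fst ?P) \<Psi>"
    unfolding C_def wedge_def \<Psi>_def[abs_def]
    by (rule continuous_map_prod_collapse[OF \<Theta>c[unfolded C_def wedge_def] NP[unfolded C_def wedge_def]])
      (auto simp: \<Theta>_def snd_cone)

  define f where "f p = (case snd p of Inl z \<Rightarrow> ?inl (H (fst p, z)) | Inr c \<Rightarrow> \<Psi> (fst p, c))" for p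
  have fc: "continuous_map (prod_topology unit_interval (disjoint_union (fst Z) (fst C))) (fst ?P) f"
  proof (rule continuous_map_prod_disjoint_union)
    have "continuous_map (prod_topology unit_interval (fst Z)) (fst Z) H"
      using H by (simp add: pointed_contraction_def)
    from continuous_map_compose[OF this inlc]
    show "continuous_map (prod_topology unit_interval (fst Z)) (fst ?P) (\<lambda>p. f (fst p, Inl (snd p)))"
      by (simp add: f_def comp_def)
    show "continuous_map (prod_topology unit_interval (fst C)) (fst ?P) (\<lambda>p. f (fst p, Inr (snd p)))"
      using \<Psi>c by (simp add: f_def)
  qed
  \<comment> \<open>Compatibility along \<open>B\<close>: base points are fixed throughout, and
    elsewhere it is \<open>\<Phi>base\<close>.\<close>
  have "f (t, p) = f (t, q)" if t: "t \<in> {0..1}" and pq: "pushout_rel B g i p q" for t p q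
  proof -
    obtain y where y: "y \<in> topspace (fst B)" and pq: "p = Inl (g y)" "q = Inr (i y)"
      using pq by (auto simp: pushout_rel_def)
    have "?inl (H (t, g y)) = \<Psi> (t, i y)"
    proof (cases y)
      case None
      then show ?thesis by (simp add: gb Hb[OF t] inlN iN \<Psi>_def)
    next
      case (Some a)
      then obtain \<alpha> x where a: "y = Some (\<alpha>, x)" and x: "\<alpha> \<in> J" "x \<in> topspace (fst S)" "x \<noteq> snd S"
        using y by (cases a) (auto simp: top_B)
      then have "i y = Some (\<alpha>, Some (x, 0))"
        by (auto simp: i_def wedge_map_def cone_base_def collapse_map_def snd_cone)
      moreover have "b \<alpha> x = y" using x a by (simp add: b_def collapse_map_def)
      ultimately show ?thesis
        using \<Phi>base[OF x(1,2) t] by (simp add: \<Psi>_def \<Theta>_def)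
    qed
    then show ?thesis by (simp add: pq f_def)
  qed
  from quotient_by_prod_universal[where r = "pushout_rel B g i", OF fc this]
  obtain G where Gc: "continuous_map (prod_topology unit_interval (fst ?P)) (fst ?P) G"
    and G: "\<And>t x. t \<in> {0..1} \<Longrightarrow> G (t, class_of (pushout_rel B g i) x) = f (t, x)"
    unfolding pushout_def fst_conv by blast
  have Gl: "G (t, ?inl z) = ?inl (H (t, z))" and Gr: "G (t, ?inr c) = \<Psi> (t, c)"
    if "t \<in> {0..1}" for t z c
    using G[OF that] by (simp_all add: pushout_inl_def pushout_inr_def f_def)
  have C: "\<Psi> (0, c) = ?inr c \<and> \<Psi> (1, c) = ?N" if c: "c \<in> topspace (fst C)" for c
  proof (cases c)
    case None
    then show ?thesis by (simp add: \<Psi>_def)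
  next
    case (Some a)
    then obtain \<alpha> q where q: "c = Some (\<alpha>, Some q)" "\<alpha> \<in> J" "q \<in> topspace (fst S) \<times> {0..1} - ?W"
      using c unfolding top_C top_cone by auto
    then obtain x s where a: "c = Some (\<alpha>, Some (x, s))"
      and x: "\<alpha> \<in> J" "x \<in> topspace (fst S)" "s \<in> {0..1}" "(x, s) \<notin> ?W"
      by (cases q) blast
    then have "e \<alpha> (x, s) = ?inr c"
      unfolding e_def collapse_map_def by simp
    then show ?thesis
      using \<Phi>start[OF x(2,3), of \<alpha>] \<Phi>end[OF x(1-3)] by (simp add: a \<Psi>_def \<Theta>_def)
  qed
  have "G (0, p) = p \<and> G (1, p) = ?N" if "p \<in> topspace (fst ?P)" for p
  proof -
    from that consider z where "z \<in> topspace (fst Z)" "p = ?inl z"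
      | c where "c \<in> topspace (fst C)" "p = ?inr c"
      by (auto simp: pushout_def topspace_quotient_by topspace_disjoint_union pushout_inl_def
          pushout_inr_def)
    then show ?thesis
      by cases (simp_all add: Gl Gr H0 H1 inlN C)
  qed
  moreover have "G (t, ?N) = ?N" if "t \<in> {0..1}" for t
    using Gl[OF that, of "snd Z"] by (simp add: inlN Hb[OF that])
  ultimately have "pointed_contraction ?P G"
    using Gc NP unfolding pointed_contraction_def pointed_space_def bP by blast
  with Gl show ?thesis by blast
qed

section \<open>Both kinds of cell attachment, up to homeomorphism\<close>

lemma pointed_map_pushout_inl: "pointed_map Z (pushout Z B C g i) (pushout_inl B g i)"
proof -
  have "continuous_map (disjoint_union (fst Z) (fst C)) (fst (pushout Z B C g i))
      (class_of (pushout_rel B g i))"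
    by (simp add: pushout_def quotient_imp_continuous_map quotient_map_quotient_by)
  then show ?thesis
    by (simp add: continuous_map_disjoint_union comp_def pushout_inl_def[abs_def] pointed_map_def
        pushout_def)
qed

lemma pointed_map_binary_wedge_inl: "pointed_map Z (binary_wedge Z W) (binary_wedge_inl Z W)"
proof -
  have "continuous_map (disjoint_union (fst Z) (fst W)) (fst (binary_wedge Z W))
      (collapse_map {Inl (snd Z), Inr (snd W)})"
    by (simp add: binary_wedge_def continuous_map_collapse_map)
  then show ?thesis
    by (simp add: continuous_map_disjoint_union comp_def binary_wedge_inl_def[abs_def]
        pointed_map_def binary_wedge_def collapse_def collapse_map_def)
qed

lemma pointed_contraction_attach_cells:
  assumes A: "pointed_contraction A K" and H: "pointed_contraction Z H"
    and X: "attach_cells n J A Z X j"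
  shows "pointed_map Z X j"
    and "\<exists>G. pointed_contraction X G \<and>
      (\<forall>t \<in> {0..1}. \<forall>z \<in> topspace (fst Z). G (t, j z) = j (H (t, z)))"
proof -
  \<comment> \<open>The part common to all dimensions: \<open>Y\<close> is the explicit wedge or
    pushout, \<open>k\<close> its canonical map from \<open>Z\<close>, and everything is carried to
    \<open>X\<close> along \<open>\<phi>\<close>.\<close>
  have *: "pointed_map Z X j \<and> (\<exists>G. pointed_contraction X G \<and>
      (\<forall>t \<in> {0..1}. \<forall>z \<in> topspace (fst Z). G (t, j z) = j (H (t, z))))"
    if Y: "pointed_contraction Y G" and \<phi>: "pointed_homeo Y X \<phi>" and k: "pointed_map Z Y k"
      and j: "\<And>z. z \<in> topspace (fst Z) \<Longrightarrow> j z = \<phi> (k z)"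
      and G: "\<And>t z. t \<in> {0..1} \<Longrightarrow> z \<in> topspace (fst Z) \<Longrightarrow> G (t, k z) = k (H (t, z))"
    for Y :: "'y pspace" and G \<phi> k
  proof
    have "continuous_map (fst Y) (fst X) \<phi>"
      using \<phi> by (simp add: pointed_homeo_def homeomorphic_imp_continuous_map)
    moreover have kc: "continuous_map (fst Z) (fst Y) k"
      using k by (simp add: pointed_map_def)
    ultimately have "continuous_map (fst Z) (fst X) (\<phi> \<circ> k)"
      by (intro continuous_map_compose)
    then have "continuous_map (fst Z) (fst X) j"
      by (rule continuous_map_eq) (simp add: j)
    moreover have "snd Z \<in> topspace (fst Z)"
      using H by (simp add: pointed_contraction_def pointed_space_def)
    ultimately show "pointed_map Z X j"
      using k \<phi> j by (simp add: pointed_map_def pointed_homeo_def)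
    obtain G' where G': "pointed_contraction X G'"
      "\<And>t y. t \<in> {0..1} \<Longrightarrow> y \<in> topspace (fst Y) \<Longrightarrow> G' (t, \<phi> y) = \<phi> (G (t, y))"
      using pointed_contraction_homeo[OF Y \<phi>] by blast
    \<comment> \<open>Both sides equal \<open>\<phi> (k (H (t, z)))\<close>. Since \<open>j\<close>
      is only known on the carrier of \<open>Z\<close>, the point \<open>H (t, z)\<close> has to lie
      there.\<close>
    have "G' (t, j z) = j (H (t, z))" if "t \<in> {0..1}" "z \<in> topspace (fst Z)" for t z
      using that G'(2)[of t "k z"] G[OF that] j pointed_contraction_in[OF H that]
        continuous_map_funspace[OF kc] by auto
    with G'(1) show "\<exists>G. pointed_contraction X G \<and>
      (\<forall>t \<in> {0..1}. \<forall>z \<in> topspace (fst Z). G (t, j z) = j (H (t, z)))"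
      by blast
  qed
  have "pointed_map Z X j \<and> (\<exists>G. pointed_contraction X G \<and>
      (\<forall>t \<in> {0..1}. \<forall>z \<in> topspace (fst Z). G (t, j z) = j (H (t, z))))"
  proof (cases n)
    case 0
    then obtain \<phi> where \<phi>: "pointed_homeo (binary_wedge Z (wedge J A)) X \<phi>"
      "\<And>z. z \<in> topspace (fst Z) \<Longrightarrow> j z = \<phi> (binary_wedge_inl Z (wedge J A) z)"
      using X by auto
    obtain W where "pointed_contraction (wedge J A) W"
      using pointed_contraction_wedge[OF A] by blast
    from pointed_contraction_binary_wedge[OF H this]
    obtain G where G: "pointed_contraction (binary_wedge Z (wedge J A)) G"
      "\<And>t z. t \<in> {0..1} \<Longrightarrow> z \<in> topspace (fst Z) \<Longrightarrow>
        G (t, binary_wedge_inl Z (wedge J A) z) = binary_wedge_inl Z (wedge J A) (H (t, z))"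
      by blast
    show ?thesis
      using *[OF G(1) \<phi>(1) pointed_map_binary_wedge_inl \<phi>(2) G(2)] by simp
  next
    case (Suc m)
    \<comment> \<open>Cells of dimension \<open>m + 1\<close> are cones on the \<open>m\<close>-fold
      suspension, which inherits a contraction from \<open>A\<close>.\<close>
    define S where "S = iter_suspension m A"
    let ?B = "wedge J S" and ?C = "wedge J (reduced_cone S)"
      and ?i = "wedge_map J (reduced_cone S) (cone_base S)"
    obtain g \<phi> where g: "pointed_map ?B Z g"
      and \<phi>: "pointed_homeo (pushout Z ?B ?C g ?i) X \<phi>"
      "\<And>z. z \<in> topspace (fst Z) \<Longrightarrow> j z = \<phi> (pushout_inl ?B g ?i z)"
      using X by (auto simp: Suc Let_def S_def)
    obtain W where "pointed_contraction S W"
      using pointed_contraction_iter_suspension[OF A] by (auto simp: S_def)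
    from pointed_contraction_pushout[OF H this g]
    obtain G where G: "pointed_contraction (pushout Z ?B ?C g ?i) G"
      "\<And>t z. t \<in> {0..1} \<Longrightarrow> z \<in> topspace (fst Z) \<Longrightarrow>
        G (t, pushout_inl ?B g ?i z) = pushout_inl ?B g ?i (H (t, z))"
      by blast
    show ?thesis
      using *[OF G(1) \<phi>(1) pointed_map_pushout_inl \<phi>(2) G(2)] by simp
  qed
  then show "pointed_map Z X j"
    and "\<exists>G. pointed_contraction X G \<and>
      (\<forall>t \<in> {0..1}. \<forall>z \<in> topspace (fst Z). G (t, j z) = j (H (t, z)))"
    by blast+
qed

section \<open>Passage to the colimit\<close>

lemma pointed_contraction_seq_colimit:
  assumes H: "\<And>n. pointed_contraction (S n) (H n)"
    and j: "\<And>n t x. t \<in> {0..1} \<Longrightarrow> x \<in> topspace (fst (S n)) \<Longrightarrow> H (Suc n) (t, j n x) = j n (H n (t, x))"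
    and jS: "\<And>n. pointed_map (S n) (S (Suc n)) (j n)"
  shows "\<exists>G. pointed_contraction (seq_colimit S j) G"
proof -
  let ?X = "seq_colimit S j" and ?U = "sum_topology (\<lambda>n. fst (S n)) UNIV"
  have pS: "pointed_space (S n)" for n
    using H by (simp add: pointed_contraction_def)
  note cocone = seq_incl_cocone[of S j, OF pS jS]
  \<comment> \<open>A point of stage \<open>n\<close> is moved by the contraction of that stage and
    then sent to the colimit. Because the contractions commute with the maps \<open>j n\<close>,
    this respects the identifications.\<close>
  define f where "f p = seq_incl S j (fst (snd p)) (H (fst (snd p)) (fst p, snd (snd p)))" for p
  have "continuous_map (prod_topology unit_interval ?U) (fst ?X) f"
  proof (rule continuous_map_prod_sum_topology)
    fix n
    have "continuous_map (prod_topology unit_interval (fst (S n))) (fst (S n)) (H n)"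
      using H by (simp add: pointed_contraction_def)
    moreover have "continuous_map (fst (S n)) (fst ?X) (seq_incl S j n)"
      using cocone(1) by (simp add: pointed_map_def)
    ultimately have "continuous_map (prod_topology unit_interval (fst (S n))) (fst ?X)
        (seq_incl S j n \<circ> H n)"
      by (rule continuous_map_compose)
    then show "continuous_map (prod_topology unit_interval (fst (S n))) (fst ?X)
        (\<lambda>p. f (fst p, n, snd p))"
      by (simp add: f_def comp_def)
  qed
  moreover have "f (t, p) = f (t, q)" if t: "t \<in> {0..1}" and pq: "seq_rel S j p q" for t p q
  proof -
    obtain n x where x: "x \<in> topspace (fst (S n))" and pq: "p = (n, x)" "q = (Suc n, j n x)"
      using pq by (auto simp: seq_rel_def)
    show ?thesis
      using j[OF t x] cocone(2)[OF pointed_contraction_in[OF H t x]] by (simp add: f_def pq)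
  qed
  ultimately obtain G
    where Gc: "continuous_map (prod_topology unit_interval (fst ?X)) (fst ?X) G"
      and G: "\<And>t p. t \<in> {0..1} \<Longrightarrow> G (t, class_of (seq_rel S j) p) = f (t, p)"
    using quotient_by_prod_universal[of ?U "fst ?X" f "seq_rel S j"]
    unfolding seq_colimit_def fst_conv by blast
  have base: "seq_incl S j n (snd (S n)) = snd ?X" for n
    using cocone(1) by (simp add: pointed_map_def)
  have Gi: "G (t, seq_incl S j n x) = seq_incl S j n (H n (t, x))" if "t \<in> {0..1}" for t n x
    using G[OF that] by (simp add: seq_incl_def f_def)
  have "G (0, p) = p \<and> G (1, p) = snd ?X" if "p \<in> topspace (fst ?X)" for p
  proof -
    obtain n x where "x \<in> topspace (fst (S n))" "p = seq_incl S j n x"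
      using \<open>p \<in> topspace (fst ?X)\<close> by (auto simp: seq_colimit_def topspace_quotient_by seq_incl_def)
    then show ?thesis
      using H[of n] base by (simp add: Gi pointed_contraction_def)
  qed
  moreover have "G (t, snd ?X) = snd ?X" if "t \<in> {0..1}" for t
    using Gi[OF that, of 0 "snd (S 0)"] H[of 0] base[of 0] that
    by (simp add: pointed_contraction_def)
  moreover have "snd ?X \<in> topspace (fst ?X)"
    using pS[of 0] by (auto simp: pointed_space_def seq_colimit_def topspace_quotient_by)
  ultimately show ?thesis
    using Gc unfolding pointed_contraction_def pointed_space_def by blast
qed

theorem corollary4p2:
  fixes A :: "'a pspace" and X :: "'x pspace"
  assumes "pointed_space A"
    and "pointed_contractible A"
    and "closedin (fst A) {snd A}"
    and "CW_complex TYPE('j) TYPE('s) A X"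
  shows "pointed_contractible X"
proof -
  obtain K where K: "pointed_contraction A K"
    using assms(1,2) pointed_contractible_iff by blast
  obtain J :: "nat \<Rightarrow> 'j set" and S :: "nat \<Rightarrow> 's pspace" and j \<phi>
    where S0: "topspace (fst (S 0)) = {snd (S 0)}"
      and S: "\<And>n. attach_cells n (J n) A (S n) (S (Suc n)) (j n)"
      and \<phi>: "pointed_homeo (seq_colimit S j) X \<phi>"
    using assms(4) unfolding CW_complex_def by blast
  \<comment> \<open>The skeleton of dimension \<open>-1\<close> is a point, so the constant map
    starts the recursion.\<close>
  have "pointed_contraction (S 0) (\<lambda>_. snd (S 0))"
    by (simp add: pointed_contraction_def pointed_space_def S0)
  \<comment> \<open>Dependent choice: each contraction is chosen after its predecessor, so that it
    extends it strictly. Independently chosen contractions need not fit together on the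
    colimit.\<close>
  then have "\<exists>H. \<forall>n. pointed_contraction (S n) (H n) \<and>
      (\<forall>t \<in> {0..1}. \<forall>x \<in> topspace (fst (S n)). H (Suc n) (t, j n x) = j n (H n (t, x)))"
    by (intro dependent_nat_choice[where
          Q = "\<lambda>n F G. \<forall>t \<in> {0..1}. \<forall>x \<in> topspace (fst (S n)). G (t, j n x) = j n (F (t, x))"])
      (use pointed_contraction_attach_cells(2)[OF K _ S] in auto)
  then obtain H where H: "\<And>n. pointed_contraction (S n) (H n)"
    and j: "\<And>n t x. t \<in> {0..1} \<Longrightarrow> x \<in> topspace (fst (S n)) \<Longrightarrow> H (Suc n) (t, j n x) = j n (H n (t, x))"
    by blast
  have "pointed_map (S n) (S (Suc n)) (j n)" for n
    by (rule pointed_contraction_attach_cells(1)[OF K H S])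
  from pointed_contraction_seq_colimit[of S H j, OF H j this] obtain G
    where "pointed_contraction (seq_colimit S j) G" by blast
  from pointed_contraction_homeo[OF this \<phi>] obtain G' where "pointed_contraction X G'" by blast
  then show ?thesis
    using pointed_contractible_iff[of X] by (auto simp: pointed_contraction_def)
qed

end
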